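(* Let $\rho\in(0,1)$ and $c\in\mathbb{R}\setminus\{0\}$, and let $(a_n)$, $(b_n)$ be sequences of positive integers with $a_n+b_n=2n$ and $\lim_{n\to\infty} a_n/b_n=\rho/(1-\rho)$. For $t\in[0,1]$ put $$L_{\rho,c}(t)=\frac1c\log\frac{e^{-ct}-e^{ct}+e^{-c(2-2\rho-t)}-e^{-c(t-2\rho)}}{e^{-c(2-2\rho)}-e^{2c\rho}}.$$ Then the boundary of the rescaled random Young diagram converges in probability, uniformly, to the curve $t\mapsto L_{\rho,c}(t)$: for every $\varepsilon>0$, $$\lim_{n\to\infty}\mathbb{P}^{e^{-c/n}}_{a_n,b_n}\Bigl(\sup_{t\in[0,1]}\bigl|\tfrac{1}{2n}X_{2tn}-L_{\rho,c}(t)\bigr|>\varepsilon\Bigr)=0 .$$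
   Context: For positive integers $a,b$ and $q>0$, $\mathbb{P}^q_{a,b}$ is the probability measure on Young diagrams (partitions) $\pi$ fitting in the box $[0,a]\times[0,b]$ (at most $a$ parts, each at most $b$) given by $\mathbb{P}^q_{a,b}(\pi)=q^{|\pi|}/Z_{a,b}(q)$, where $|\pi|$ is the number of unit squares of $\pi$ and $Z_{a,b}(q)=\sum_\pi q^{|\pi|}$. The boundary of $\pi$ is encoded as a lattice path $(X_k)_{0\le k\le a+b}$ with $X_0=0$, $X_{a+b}=b-a$, $X_{k+1}-X_k\in\{+1,-1\}$ (so $b$ up-steps and $a$ down-steps). The diagram consists of the unit cells lying between this path and the lower boundary of the bounding rectangle (the path with $a$ down-steps followed by $b$ up-steps); thus $|\pi|$ is the number of pairs consisting of an up-step and a later down-step. Every such path corresponds to exactly one $\pi$. The path is extended to a continuous piecewise linear function $s\mapsto X_s$ on $[0,a+b]$, linear between consecutive integers. *)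

theory Defs
  imports "HOL-Probability.Probability"
begin

section \<open>Young diagrams in a box\<close>

text \<open>A Young diagram is given by its weakly decreasing sequence of row lengths
  \<open>p 0 \<ge> p 1 \<ge> \<dots>\<close>, padded by zeros.\<close>

definition box_partitions :: "nat \<Rightarrow> nat \<Rightarrow> (nat \<Rightarrow> nat) set" where
  "box_partitions a b = {p. antimono p \<and> (\<forall>i. p i \<le> b) \<and> (\<forall>i\<ge>a. p i = 0)}"

definition diagram_size :: "nat \<Rightarrow> (nat \<Rightarrow> nat) \<Rightarrow> nat" where
  "diagram_size a p = (\<Sum>i<a. p i)"

definition partition_fn :: "nat \<Rightarrow> nat \<Rightarrow> real \<Rightarrow> real" where
  "partition_fn a b q = (\<Sum>p\<in>box_partitions a b. q ^ diagram_size a p)"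

definition qvol_pmf :: "nat \<Rightarrow> nat \<Rightarrow> real \<Rightarrow> (nat \<Rightarrow> nat) pmf" where
  "qvol_pmf a b q = embed_pmf (\<lambda>p. if p \<in> box_partitions a b
     then q ^ diagram_size a p / partition_fn a b q else 0)"

section \<open>The boundary path\<close>

text \<open>Each row of the diagram contributes one down-step of the boundary. Row \<open>i\<close> is met after the
  \<open>a - Suc i\<close> rows \<open>i + 1, \<dots>, a - 1\<close>, and its down-step is preceded by exactly \<open>p i\<close> up-steps, one
  for each cell of the row. Thus the empty diagram has the boundary with all \<open>a\<close> down-steps first, and
  the largest row \<open>p 0\<close> belongs to the last down-step.\<close>

definition down_step :: "nat \<Rightarrow> (nat \<Rightarrow> nat) \<Rightarrow> nat \<Rightarrow> bool" where
  "down_step a p l \<longleftrightarrow> (\<exists>i<a. l = p i + (a - Suc i))"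

definition boundary :: "nat \<Rightarrow> (nat \<Rightarrow> nat) \<Rightarrow> nat \<Rightarrow> int" where
  "boundary a p k = (\<Sum>l<k. if down_step a p l then -1 else 1)"

definition boundary_lin :: "nat \<Rightarrow> (nat \<Rightarrow> nat) \<Rightarrow> real \<Rightarrow> real" where
  "boundary_lin a p s =
     (let k = nat \<lfloor>s\<rfloor> in real_of_int (boundary a p k)
        + (s - real k) * real_of_int (boundary a p (Suc k) - boundary a p k))"

section \<open>The limit curve\<close>

definition limit_curve :: "real \<Rightarrow> real \<Rightarrow> real \<Rightarrow> real" where
  "limit_curve \<rho> c t =
     1 / c * ln ((exp (- c * t) - exp (c * t) + exp (- c * (2 - 2 * \<rho> - t)) - exp (- c * (t - 2 * \<rho>)))
       / (exp (- c * (2 - 2 * \<rho>)) - exp (2 * c * \<rho>)))"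

section \<open>Consistency of the encoding\<close>

lemma finite_box_partitions: "finite (box_partitions a b)"
proof (rule finite_subset)
  show "box_partitions a b \<subseteq> {f. \<forall>i. (i \<in> {..<a} \<longrightarrow> f i \<in> {..b}) \<and> (i \<notin> {..<a} \<longrightarrow> f i = 0)}"
    by (auto simp: box_partitions_def)
  show "finite {f. \<forall>i. (i \<in> {..<a} \<longrightarrow> f i \<in> {..b}) \<and> (i \<notin> {..<a} \<longrightarrow> f i = (0::nat))}"
    by (rule finite_set_of_finite_funs) auto
qed

lemma partition_fn_pos:
  assumes "q > 0"
  shows "partition_fn a b q > 0"
proof -
  have "(\<lambda>_. 0) \<in> box_partitions a b"
    by (auto simp: box_partitions_def intro: antimonoI)
  then show ?thesis
    unfolding partition_fn_def using assms finite_box_partitions by (intro sum_pos) auto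
qed

lemma pmf_qvol_pmf:
  assumes "q > 0"
  shows "pmf (qvol_pmf a b q) p =
    (if p \<in> box_partitions a b then q ^ diagram_size a p / partition_fn a b q else 0)"
proof -
  let ?f = "\<lambda>p. if p \<in> box_partitions a b then q ^ diagram_size a p / partition_fn a b q else 0"
  have pos: "partition_fn a b q > 0"
    using assms by (rule partition_fn_pos)
  have nn: "?f x \<ge> 0" for x
    using assms pos by simp
  have "(\<integral>\<^sup>+x. ennreal (?f x) \<partial>count_space UNIV) = (\<Sum>x\<in>box_partitions a b. ennreal (?f x))"
    by (rule nn_integral_count_space') (auto simp: finite_box_partitions)
  also have "\<dots> = ennreal (\<Sum>x\<in>box_partitions a b. ?f x)"
    using nn by (rule sum_ennreal)
  also have "(\<Sum>x\<in>box_partitions a b. ?f x) = 1"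
    using pos by (simp add: partition_fn_def flip: sum_divide_distrib)
  finally show ?thesis
    unfolding qvol_pmf_def using nn by (subst pmf_embed_pmf) auto
qed

lemma down_position_strict:
  assumes "p \<in> box_partitions a b" "i < j" "j < a"
  shows "p j + (a - Suc j) < p i + (a - Suc i)"
proof -
  have "p j \<le> p i"
    using assms by (auto simp: box_partitions_def antimono_def)
  with assms show ?thesis by linarith
qed

lemma inj_down_position:
  assumes "p \<in> box_partitions a b"
  shows "inj_on (\<lambda>i. p i + (a - Suc i)) {..<a}"
proof (rule inj_onI)
  fix i j assume "i \<in> {..<a}" "j \<in> {..<a}" "p i + (a - Suc i) = p j + (a - Suc j)"
  then show "i = j"
    using down_position_strict[OF assms, of i j] down_position_strict[OF assms, of j i]
    by (cases i j rule: linorder_cases) auto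
qed

lemma down_steps_eq: "{l. down_step a p l} = (\<lambda>i. p i + (a - Suc i)) ` {..<a}"
  by (auto simp: down_step_def)

lemma down_steps_subset:
  assumes "p \<in> box_partitions a b"
  shows "{l. down_step a p l} \<subseteq> {..<a + b}"
proof
  fix l assume "l \<in> {l. down_step a p l}"
  then obtain i where "i < a" "l = p i + (a - Suc i)"
    by (auto simp: down_step_def)
  moreover have "p i \<le> b"
    using assms by (auto simp: box_partitions_def)
  ultimately have "l < a + b" by linarith
  then show "l \<in> {..<a + b}" by simp
qed

lemma card_down_steps:
  assumes "p \<in> box_partitions a b"
  shows "card {l. down_step a p l} = a"
  unfolding down_steps_eq card_image[OF inj_down_position[OF assms]] by simp

lemma card_down_steps_before:
  assumes p: "p \<in> box_partitions a b" and "i < a"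
  shows "card {l. l < p i + (a - Suc i) \<and> down_step a p l} = a - Suc i"
proof -
  have "{l. l < p i + (a - Suc i) \<and> down_step a p l} = (\<lambda>j. p j + (a - Suc j)) ` {i<..<a}"
  proof (intro set_eqI iffI)
    fix u assume "u \<in> {l. l < p i + (a - Suc i) \<and> down_step a p l}"
    then obtain j where j: "j < a" "u = p j + (a - Suc j)" "p j + (a - Suc j) < p i + (a - Suc i)"
      by (auto simp: down_step_def)
    then have "i < j"
      using down_position_strict[OF p, of j i] assms(2) by (cases i j rule: linorder_cases) auto
    with j show "u \<in> (\<lambda>j. p j + (a - Suc j)) ` {i<..<a}" by auto
  next
    fix u assume "u \<in> (\<lambda>j. p j + (a - Suc j)) ` {i<..<a}"
    then show "u \<in> {l. l < p i + (a - Suc i) \<and> down_step a p l}"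
      using down_position_strict[OF p, of i] by (auto simp: down_step_def)
  qed
  moreover have "inj_on (\<lambda>j. p j + (a - Suc j)) {i<..<a}"
    by (rule inj_on_subset[OF inj_down_position[OF p]]) auto
  ultimately show ?thesis
    by (metis card_image card_greaterThanLessThan)
qed

lemma boundary_0: "boundary a p 0 = 0"
  by (simp add: boundary_def)

lemma boundary_lin_of_nat: "boundary_lin a p (real k) = boundary a p k"
  by (simp add: boundary_lin_def)

lemma boundary_end:
  assumes "p \<in> box_partitions a b"
  shows "boundary a p (a + b) = int b - int a"
proof -
  have D: "{..<a + b} \<inter> {l. down_step a p l} = {l. down_step a p l}"
    using down_steps_subset[OF assms] by auto
  have "card ({..<a + b} \<inter> - {l. down_step a p l}) = card ({..<a + b} - {l. down_step a p l})"
    by (simp add: Diff_eq)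
  also have "\<dots> = b"
    using down_steps_subset[OF assms] card_down_steps[OF assms]
    by (subst card_Diff_subset) (auto intro: finite_subset)
  finally show ?thesis
    using card_down_steps[OF assms] D by (simp add: boundary_def sum.If_cases)
qed

text \<open>The size of the diagram is the number of pairs of an up-step and a later down-step.\<close>

lemma diagram_size_eq_card_pairs:
  assumes p: "p \<in> box_partitions a b"
  shows "diagram_size a p = card {(u, d). u < d \<and> d < a + b \<and> \<not> down_step a p u \<and> down_step a p d}"
proof -
  let ?d = "\<lambda>i. p i + (a - Suc i)"
  have up: "card {u. u < ?d i \<and> \<not> down_step a p u} = p i" if "i < a" for i
  proof -
    have "{u. u < ?d i \<and> \<not> down_step a p u} = {..<?d i} - {u. u < ?d i \<and> down_step a p u}"
      by auto
    also have "card \<dots> = ?d i - card {u. u < ?d i \<and> down_step a p u}"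
      by (subst card_Diff_subset) auto
    finally show ?thesis
      using card_down_steps_before[OF p that] by simp
  qed
  define S where "S = (SIGMA i:{..<a}. {u. u < ?d i \<and> \<not> down_step a p u})"
  have "{(u, d). u < d \<and> d < a + b \<and> \<not> down_step a p u \<and> down_step a p d} =
      (\<lambda>(i, u). (u, ?d i)) ` S"
  proof (intro set_eqI iffI)
    fix x assume "x \<in> {(u, d). u < d \<and> d < a + b \<and> \<not> down_step a p u \<and> down_step a p d}"
    then obtain u i where "x = (u, ?d i)" "i < a" "u < ?d i" "\<not> down_step a p u"
      by (auto simp: down_step_def)
    then show "x \<in> (\<lambda>(i, u). (u, ?d i)) ` S"
      by (intro image_eqI[of _ _ "(i, u)"]) (auto simp: S_def)
  next
    fix x assume "x \<in> (\<lambda>(i, u). (u, ?d i)) ` S"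
    then obtain u i where x: "x = (u, ?d i)" "i < a" "u < ?d i" "\<not> down_step a p u"
      by (auto simp: S_def)
    then have "down_step a p (?d i)"
      by (auto simp: down_step_def)
    then show "x \<in> {(u, d). u < d \<and> d < a + b \<and> \<not> down_step a p u \<and> down_step a p d}"
      using down_steps_subset[OF p] x by blast
  qed
  moreover have "inj_on (\<lambda>(i, u). (u, ?d i)) S"
  proof (rule inj_onI)
    fix x y assume "x \<in> S" "y \<in> S" "(\<lambda>(i, u). (u, ?d i)) x = (\<lambda>(i, u). (u, ?d i)) y"
    then show "x = y"
      using inj_onD[OF inj_down_position[OF p], of "fst x" "fst y"]
      by (cases x; cases y) (simp add: S_def)
  qed
  ultimately have "card {(u, d). u < d \<and> d < a + b \<and> \<not> down_step a p u \<and> down_step a p d} = card S"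
    by (simp only: card_image)
  also have "\<dots> = (\<Sum>i<a. p i)"
    unfolding S_def using up by (subst card_SigmaI) auto
  finally show ?thesis
    by (simp add: diagram_size_def)
qed

text \<open>Lattice paths with \<open>a\<close> down-steps and \<open>b\<close> up-steps correspond bijectively to diagrams.\<close>

lemma bij_betw_down_steps:
  "bij_betw (\<lambda>p. {l. down_step a p l}) (box_partitions a b) {D. D \<subseteq> {..<a + b} \<and> card D = a}"
  unfolding bij_betw_def
proof
  show "inj_on (\<lambda>p. {l. down_step a p l}) (box_partitions a b)"
  proof (rule inj_onI, rule ext)
    fix p p' i
    assume p: "p \<in> box_partitions a b" "p' \<in> box_partitions a b"
      and eq: "{l. down_step a p l} = {l. down_step a p' l}"
    have ds: "down_step a p l = down_step a p' l" for l
      using eq by blast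
    show "p i = p' i"
    proof (cases "i < a")
      case True
      then obtain j where j: "j < a" "p i + (a - Suc i) = p' j + (a - Suc j)"
        using ds[of "p i + (a - Suc i)"] by (auto simp: down_step_def)
      have "a - Suc i = a - Suc j"
        using card_down_steps_before[OF p(1) True] card_down_steps_before[OF p(2) j(1)] unfolding j(2) ds
        by (rule trans[OF sym])
      with True j(1) have "i = j" by linarith
      with j(2) show ?thesis by simp
    next
      case False
      with p show ?thesis by (simp add: box_partitions_def)
    qed
  qed
  show "(\<lambda>p. {l. down_step a p l}) ` box_partitions a b = {D. D \<subseteq> {..<a + b} \<and> card D = a}"
  proof (intro equalityI subsetI)
    fix D assume "D \<in> (\<lambda>p. {l. down_step a p l}) ` box_partitions a b"
    then show "D \<in> {D. D \<subseteq> {..<a + b} \<and> card D = a}"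
      using down_steps_subset[of _ a b] card_down_steps[of _ a b] by blast
  next
    fix D assume "D \<in> {D. D \<subseteq> {..<a + b} \<and> card D = a}"
    then have D: "D \<subseteq> {..<a + b}" "card D = a" by auto
    then have fin: "finite D" by (auto intro: finite_subset)
    define xs where "xs = sorted_list_of_set D"
    have xs: "length xs = a" "set xs = D" "sorted_wrt (<) xs"
      using fin D by (simp_all add: xs_def strict_sorted_list_of_set)
    have step: "xs ! i + (j - i) \<le> xs ! j" if "i \<le> j" "j < a" for i j
      using that
    proof (induction j rule: dec_induct)
      case (step n)
      then have "xs ! n < xs ! Suc n"
        using sorted_wrt_nth_less[OF xs(3), of n "Suc n"] xs(1) by auto
      moreover have "xs ! i + (n - i) \<le> xs ! n"
        using step by simp
      ultimately show ?case
        using step.hyps by linarith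
    qed simp
    have lo: "j \<le> xs ! j" if "j < a" for j
      using step[of 0 j] that by simp
    have hi: "xs ! j \<le> b + j" if "j < a" for j
    proof -
      have "xs ! (a - 1) \<in> D"
        using that xs by (metis diff_less less_nat_zero_code nth_mem not_gr_zero zero_less_one)
      then have "xs ! (a - 1) < a + b" using D by auto
      with step[of j "a - 1"] that show ?thesis by linarith
    qed
    define p where "p i = (if i < a then xs ! (a - Suc i) - (a - Suc i) else 0)" for i
    have eq: "p i + (a - Suc i) = xs ! (a - Suc i)" if "i < a" for i
      using lo[of "a - Suc i"] that by (simp add: p_def)
    have "p \<in> box_partitions a b"
      unfolding box_partitions_def
    proof (intro CollectI conjI allI impI antimonoI)
      fix i j :: nat assume "i \<le> j"
      then show "p j \<le> p i"
      proof (cases "j < a")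
        case True
        with \<open>i \<le> j\<close> have "a - Suc j \<le> a - Suc i" "a - Suc i < a" "i < a"
          by linarith+
        then show ?thesis
          using step[of "a - Suc j" "a - Suc i"] eq[of i] eq[of j] True by linarith
      qed (simp add: p_def)
    next
      fix i show "p i \<le> b"
        using hi[of "a - Suc i"] by (auto simp: p_def)
    qed (simp add: p_def)
    moreover have "{l. down_step a p l} = D"
    proof -
      have "{l. down_step a p l} = (\<lambda>i. xs ! (a - Suc i)) ` {..<a}"
        using eq by (auto simp: down_steps_eq)
      also have "\<dots> = (!) xs ` (\<lambda>i. a - Suc i) ` {..<a}"
        by (simp add: image_image)
      also have "(\<lambda>i. a - Suc i) ` {..<a} = {..<a}"
      proof (intro equalityI subsetI)
        fix i assume "i \<in> {..<a}"
        then show "i \<in> (\<lambda>i. a - Suc i) ` {..<a}"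
          by (intro image_eqI[of _ _ "a - Suc i"]) auto
      qed auto
      also have "(!) xs ` {..<a} = D"
        using xs by (auto simp: set_conv_nth)
      finally show ?thesis .
    qed
    ultimately show "D \<in> (\<lambda>p. {l. down_step a p l}) ` box_partitions a b"
      by blast
  qed
qed

end

theory Submission
  imports Defs "HOL-Real_Asymp.Real_Asymp"
begin

text \<open>
  Why the theorem holds. Let \<open>D\<close> be the set of positions of the down-steps of the boundary path. It is a
  subset of \<open>{..<a + b}\<close> with \<open>a\<close> elements, and \<open>|\<pi>|\<close> equals the sum of the elements of \<open>D\<close> up to a
  constant. So the weight of \<open>D\<close> is a product over its elements: the path has independent steps,
  conditioned on the number of down-steps. If step \<open>l\<close> goes down with probability \<open>p l\<close>, the odds
  \<open>p l / (1 - p l)\<close> must be proportional to \<open>q ^ l\<close> (lemma \<open>prob_qvol_pmf_eq\<close>); the factor of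
  proportionality is free, and conditioning changes little if the \<open>p l\<close> add up to about \<open>a\<close>.

  With \<open>q = exp (- c / n)\<close> the logistic densities \<open>down_density A c t\<close> at \<open>t = l / (2 n)\<close> have such odds.
  The drift \<open>1 - 2 * down_density A c t\<close> is the derivative of \<open>log_mix A c\<close>, that is \<open>1 / c\<close> times the logarithm
  of a convex combination of \<open>exp (c t)\<close> and \<open>exp (- c t)\<close>. For one choice of \<open>A\<close> this function is the limit curve; its
  value \<open>1 - 2 \<rho>\<close> at time 1 says that the \<open>p l\<close> add up to \<open>2 n \<rho>\<close> within a bounded error, which is
  \<open>a\<close> within \<open>o(n)\<close>.

  It remains to show that the path stays near its drift, that is, that
  \<open>deviation p D m = (\<Sum>l<m. of_bool (l \<in> D) - p l)\<close> is small compared to \<open>n\<close> for all \<open>m\<close> at once. The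
  conditioning destroys independence, but an exchange symmetry remains. Swapping the roles of a
  position in \<open>D\<close> and one outside changes the weight by a known factor, so a certain antisymmetric
  quantity \<open>flux p D l k\<close> has mean zero, and the fluxes of disjoint pairs are orthogonal. Therefore the
  sum of about \<open>n\<^sup>2\<close> fluxes has second moment only \<open>O(n\<^sup>3)\<close> (lemma \<open>second_moment_flux\<close>). On the other
  hand, the sum of a row of fluxes is \<open>of_bool (l \<in> D) - p l\<close> times a factor of order \<open>n\<close> that does
  not depend on \<open>l\<close>, up to the defect \<open>a - (\<Sum>k. p k)\<close> (lemma \<open>sum_flux_row\<close>). Dividing gives a
  second moment \<open>O(n)\<close>, plus the squared defect, for each deviation.

  To control all times at once, observe that the deviation changes by at most 1 per step, so a value
  of order \<open>n\<close> forces a whole interval of such values, and the sum of the squared deviations over all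
  times is then of order \<open>n\<^sup>3\<close>. Its mean is \<open>o(n\<^sup>3)\<close>, and Markov's inequality
  finishes the argument.
\<close>

section \<open>Independent steps conditioned on their number\<close>

definition layer :: "nat \<Rightarrow> nat \<Rightarrow> nat set set" where
  "layer N a = {D. D \<subseteq> {..<N} \<and> card D = a}"

text \<open>Up to the factor \<open>\<Prod>l<N. 1 - p l\<close>, the probability that independent trials with success
  probabilities \<open>p l\<close> succeed exactly on \<open>D\<close>. Only ratios of such weights matter, so the factor is
  left out.\<close>

definition odds_weight :: "(nat \<Rightarrow> real) \<Rightarrow> nat set \<Rightarrow> real" where
  "odds_weight p D = (\<Prod>l\<in>D. p l / (1 - p l))"

text \<open>Moving an element of \<open>D\<close> from \<open>l\<close> to \<open>k\<close> multiplies the weight by the quotient of the odds of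
  \<open>k\<close> and \<open>l\<close>. Weighting the two possible states of the pair by the odds of \<open>k\<close> and of \<open>l\<close>
  therefore makes them cancel on average. The coefficients below are these odds, both scaled by
  \<open>(1 - p l) * (1 - p k)\<close>, which makes the row sums in \<open>sum_flux_row\<close> collapse.\<close>

definition flux :: "(nat \<Rightarrow> real) \<Rightarrow> nat set \<Rightarrow> nat \<Rightarrow> nat \<Rightarrow> real" where
  "flux p D l k = of_bool (l \<in> D \<and> k \<notin> D) * (p k * (1 - p l))
     - of_bool (k \<in> D \<and> l \<notin> D) * (p l * (1 - p k))"

definition deviation :: "(nat \<Rightarrow> real) \<Rightarrow> nat set \<Rightarrow> nat \<Rightarrow> real" where
  "deviation p D m = (\<Sum>l<m. of_bool (l \<in> D) - p l)"

lemma finite_layer: "finite (layer N a)"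
  by (rule finite_subset[of _ "Pow {..<N}"]) (auto simp: layer_def)

lemma finite_of_layer: "D \<in> layer N a \<Longrightarrow> finite D"
  by (auto simp: layer_def intro: finite_subset)

lemma odds_weight_nonneg:
  assumes "D \<in> layer N a" "\<And>l. l < N \<Longrightarrow> 0 < p l \<and> p l < 1"
  shows "odds_weight p D \<ge> 0"
  unfolding odds_weight_def
proof (rule prod_nonneg)
  fix l assume "l \<in> D"
  with assms(1) have "l < N" by (auto simp: layer_def)
  with assms(2) show "0 \<le> p l / (1 - p l)" by (simp add: less_imp_le)
qed

text \<open>Detailed balance: the exchange of \<open>l\<close> and \<open>k\<close> matches the sets that contribute to the two terms
  of the flux, and matched contributions are equal. A factor \<open>H\<close> that cannot see the exchange goes
  through.\<close>

lemma flux_orthogonal: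
  assumes p: "\<And>i. i < N \<Longrightarrow> 0 < p i \<and> p i < 1" and lk: "l < N" "k < N" "l \<noteq> k"
    and H: "\<And>D. l \<in> D \<Longrightarrow> k \<notin> D \<Longrightarrow> H (insert k (D - {l})) = H D"
  shows "(\<Sum>D\<in>layer N a. odds_weight p D * (flux p D l k * H D)) = 0"
proof -
  let ?A = "{D \<in> layer N a. l \<in> D \<and> k \<notin> D}" and ?B = "{D \<in> layer N a. k \<in> D \<and> l \<notin> D}"
  let ?w = "odds_weight p"
  have split: "?w D * (flux p D l k * H D) =
      of_bool (l \<in> D \<and> k \<notin> D) * (?w D * (p k * (1 - p l)) * H D)
      - of_bool (k \<in> D \<and> l \<notin> D) * (?w D * (p l * (1 - p k)) * H D)" for D
    by (simp add: flux_def algebra_simps)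
  have "(\<Sum>D\<in>layer N a. ?w D * (flux p D l k * H D)) =
      (\<Sum>D\<in>?A. ?w D * (p k * (1 - p l)) * H D) - (\<Sum>D\<in>?B. ?w D * (p l * (1 - p k)) * H D)"
    unfolding split sum_subtractf
    by (simp add: sum.inter_filter[OF finite_layer] of_bool_def if_distrib[of "\<lambda>x. x * _"] cong: if_cong)
  also have "(\<Sum>D\<in>?A. ?w D * (p k * (1 - p l)) * H D) = (\<Sum>D\<in>?B. ?w D * (p l * (1 - p k)) * H D)"
  proof (rule sum.reindex_bij_witness[of _ "\<lambda>D. insert l (D - {k})" "\<lambda>D. insert k (D - {l})"])
    fix D assume D: "D \<in> ?A"
    then have fin: "finite D" and sub: "D \<subseteq> {..<N}" by (auto intro: finite_of_layer simp: layer_def)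
    show "insert l (insert k (D - {l}) - {k}) = D" using D lk by auto
    have "card (insert k (D - {l})) = Suc (card (D - {l}))"
      using D fin by (intro card_insert_disjoint) auto
    also have "\<dots> = a"
      using D fin by (subst card_Suc_Diff1) (auto simp: layer_def)
    finally have "card (insert k (D - {l})) = a" .
    then show "insert k (D - {l}) \<in> ?B" using D lk by (auto simp: layer_def)
    have "?w D = p l / (1 - p l) * ?w (D - {l})"
      unfolding odds_weight_def using D fin by (intro prod.remove) auto
    moreover have "?w (insert k (D - {l})) = p k / (1 - p k) * ?w (D - {l})"
      unfolding odds_weight_def using D fin by (intro prod.insert) auto
    ultimately show "?w (insert k (D - {l})) * (p l * (1 - p k)) * H (insert k (D - {l}))
        = ?w D * (p k * (1 - p l)) * H D"
      using H[of D] D p[OF lk(1)] p[OF lk(2)] by simp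
  next
    fix D assume D: "D \<in> ?B"
    then have fin: "finite D" by (auto intro: finite_of_layer)
    show "insert k (insert l (D - {k}) - {l}) = D" using D lk by auto
    have "card (insert l (D - {k})) = Suc (card (D - {k}))"
      using D fin by (intro card_insert_disjoint) auto
    also have "\<dots> = a"
      using D fin by (subst card_Suc_Diff1) (auto simp: layer_def)
    finally have "card (insert l (D - {k})) = a" .
    then show "insert l (D - {k}) \<in> ?A" using D lk by (auto simp: layer_def)
  qed
  finally show ?thesis by simp
qed

lemma abs_flux_le:
  assumes "0 < p l" "p l < 1" "0 < p k" "p k < 1"
  shows "\<bar>flux p D l k\<bar> \<le> 1"
proof -
  have "0 \<le> p k * (1 - p l)" "p k * (1 - p l) \<le> 1" "0 \<le> p l * (1 - p k)" "p l * (1 - p k) \<le> 1"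
    using assms by (auto intro: mult_le_one)
  then show ?thesis by (auto simp: flux_def)
qed

text \<open>After expanding the square, a pair of fluxes over four distinct positions contributes nothing,
  since the second flux cannot see an exchange made for the first. Fluxes have absolute value at most 1,
  and at most \<open>4 N\<close> pairs share a position with a given one.\<close>

lemma second_moment_flux:
  assumes p: "\<And>i. i < N \<Longrightarrow> 0 < p i \<and> p i < 1" and "m \<le> N"
  shows "(\<Sum>D\<in>layer N a. odds_weight p D * (\<Sum>l<m. \<Sum>k<N. flux p D l k)\<^sup>2)
    \<le> 4 * real N ^ 3 * (\<Sum>D\<in>layer N a. odds_weight p D)"
proof -
  let ?w = "odds_weight p" and ?I = "{..<m} \<times> {..<N}"
  let ?T = "\<Sum>D\<in>layer N a. ?w D"
  define f where "f D x = flux p D (fst x) (snd x)" for D x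
  define meet where "meet x y \<longleftrightarrow> fst y \<in> {fst x, snd x} \<or> snd y \<in> {fst x, snd x}" for x y :: "nat \<times> nat"
  have T: "?T \<ge> 0"
    by (intro sum_nonneg odds_weight_nonneg p)
  have f: "(\<Sum>l<m. \<Sum>k<N. flux p D l k) = (\<Sum>x\<in>?I. f D x)" for D
    by (simp add: f_def sum.cartesian_product split_def)
  have "(\<Sum>D\<in>layer N a. ?w D * (\<Sum>l<m. \<Sum>k<N. flux p D l k)\<^sup>2)
      = (\<Sum>D\<in>layer N a. \<Sum>x\<in>?I. \<Sum>y\<in>?I. ?w D * (f D x * f D y))"
    by (simp only: f power2_eq_square sum_product) (simp only: sum_distrib_left)
  also have "\<dots> = (\<Sum>x\<in>?I. \<Sum>y\<in>?I. \<Sum>D\<in>layer N a. ?w D * (f D x * f D y))"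
    by (subst sum.swap, rule sum.cong[OF refl], subst sum.swap, rule refl)
  also have "\<dots> \<le> (\<Sum>x\<in>?I. \<Sum>y\<in>?I. of_bool (meet x y) * ?T)"
  proof (intro sum_mono)
    fix x y assume xy: "x \<in> ?I" "y \<in> ?I"
    then have b: "fst x < N" "snd x < N" "fst y < N" "snd y < N"
      using \<open>m \<le> N\<close> by auto
    show "(\<Sum>D\<in>layer N a. ?w D * (f D x * f D y)) \<le> of_bool (meet x y) * ?T"
    proof (cases "meet x y")
      case True
      have "?w D * (f D x * f D y) \<le> ?w D * 1" if "D \<in> layer N a" for D
      proof (rule mult_left_mono)
        have "\<bar>f D x\<bar> \<le> 1" "\<bar>f D y\<bar> \<le> 1"
          unfolding f_def using p b by (auto intro!: abs_flux_le)
        then have "\<bar>f D x\<bar> * \<bar>f D y\<bar> \<le> 1" by (intro mult_le_one) auto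
        then show "f D x * f D y \<le> 1" by (metis abs_le_D1 abs_mult)
      qed (use odds_weight_nonneg[OF that p] in auto)
      then have "(\<Sum>D\<in>layer N a. ?w D * (f D x * f D y)) \<le> (\<Sum>D\<in>layer N a. ?w D * 1)"
        by (rule sum_mono)
      with True show ?thesis by simp
    next
      case False
      show ?thesis
      proof (cases "fst x = snd x")
        case True
        then show ?thesis using T by (simp add: f_def flux_def)
      next
        case neq: False
        have "(\<Sum>D\<in>layer N a. ?w D * (f D x * f D y)) = 0"
          unfolding f_def using b neq False
          by (intro flux_orthogonal p) (auto simp: flux_def meet_def)
        then show ?thesis using T by simp
      qed
    qed
  qed
  also have "\<dots> \<le> (\<Sum>x\<in>?I. 4 * real N * ?T)"
  proof (rule sum_mono)
    fix x assume "x \<in> ?I"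
    have "card {y \<in> ?I. meet x y} \<le> card ({fst x, snd x} \<times> {..<N} \<union> {..<N} \<times> {fst x, snd x})"
      using \<open>m \<le> N\<close> by (intro card_mono) (auto simp: meet_def)
    also have "\<dots> \<le> card ({fst x, snd x} \<times> {..<N}) + card ({..<N} \<times> {fst x, snd x})"
      by (rule card_Un_le)
    also have "\<dots> = 2 * (card {fst x, snd x} * N)"
      by (simp add: card_cartesian_product)
    also have "\<dots> \<le> 4 * N"
      using card_insert_le_m1[of 2 "{snd x}" "fst x"] by simp
    finally have "real (card {y \<in> ?I. meet x y}) \<le> 4 * real N"
      by linarith
    then have le: "real (card {y \<in> ?I. meet x y}) * ?T \<le> 4 * real N * ?T"
      using T by (rule mult_right_mono)
    have "{y \<in> ?I. meet x y} = ?I \<inter> Collect (meet x)" by blast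
    then have "(\<Sum>y\<in>?I. of_bool (meet x y) * ?T) = real (card {y \<in> ?I. meet x y}) * ?T"
      by (simp flip: sum_distrib_right)
    with le show "(\<Sum>y\<in>?I. of_bool (meet x y) * ?T) \<le> 4 * real N * ?T"
      by (simp only:)
  qed
  also have "\<dots> = real m * (4 * real N ^ 2 * ?T)"
    by (simp add: power2_eq_square)
  also have "\<dots> \<le> real N * (4 * real N ^ 2 * ?T)"
    using \<open>m \<le> N\<close> T by (intro mult_right_mono) auto
  also have "\<dots> = 4 * real N ^ 3 * ?T"
    by (simp add: power2_eq_square power3_eq_cube)
  finally show ?thesis .
qed

text \<open>This identity turns fluxes back into deviations. Both
  \<open>\<Sum>k<N. of_bool (k \<notin> D) * p k\<close> and \<open>\<Sum>k<N. of_bool (k \<in> D) * (1 - p k)\<close> occur in the row sum, and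
  they differ by the constant \<open>a - (\<Sum>k<N. p k)\<close> because \<open>D\<close> has \<open>a\<close> elements. The first factor on
  the right is random, but it is the same for all \<open>l\<close> and is bounded below when the \<open>p k\<close> are, so one
  can sum over \<open>l\<close> and divide by it.\<close>

lemma sum_flux_row:
  assumes D: "D \<in> layer N a"
  shows "(\<Sum>k<N. flux p D l k) = (\<Sum>k<N. of_bool (k \<notin> D) * p k) * (of_bool (l \<in> D) - p l)
    - of_bool (l \<notin> D) * p l * (real a - (\<Sum>k<N. p k))"
proof -
  define W where "W = (\<Sum>k<N. of_bool (k \<notin> D) * p k)"
  have "(\<Sum>k<N. of_bool (k \<in> D)) = real a"
    using D by (simp add: layer_def of_bool_def Int_absorb1 flip: sum.inter_restrict)
  moreover have "(\<Sum>k<N. of_bool (k \<in> D) * (1 - p k)) = (\<Sum>k<N. of_bool (k \<in> D) - p k + of_bool (k \<notin> D) * p k)"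
    by (rule sum.cong) auto
  ultimately have V: "(\<Sum>k<N. of_bool (k \<in> D) * (1 - p k)) = W + (real a - (\<Sum>k<N. p k))"
    by (simp add: sum.distrib sum_subtractf W_def)
  have "flux p D l k = of_bool (l \<in> D) * (1 - p l) * (of_bool (k \<notin> D) * p k)
      - of_bool (l \<notin> D) * p l * (of_bool (k \<in> D) * (1 - p k))" for k
    by (auto simp: flux_def)
  then have "(\<Sum>k<N. flux p D l k) = of_bool (l \<in> D) * (1 - p l) * W
      - of_bool (l \<notin> D) * p l * (W + (real a - (\<Sum>k<N. p k)))"
    by (simp add: sum_subtractf V W_def flip: sum_distrib_left)
  then show ?thesis
    unfolding W_def[symmetric] by (auto simp: algebra_simps)
qed

lemma deviation_mult_le:
  assumes p: "\<And>i. i < N \<Longrightarrow> 0 < p i \<and> p i < 1" and D: "D \<in> layer N a" and "m \<le> N"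
  shows "\<bar>(\<Sum>k<N. of_bool (k \<notin> D) * p k) * deviation p D m\<bar>
    \<le> \<bar>\<Sum>l<m. \<Sum>k<N. flux p D l k\<bar> + real N * \<bar>real a - (\<Sum>k<N. p k)\<bar>"
proof -
  define u where "u = (\<Sum>l<m. of_bool (l \<notin> D) * p l)"
  define W where "W = (\<Sum>k<N. of_bool (k \<notin> D) * p k)"
  define \<Delta> where "\<Delta> = real a - (\<Sum>k<N. p k)"
  have row: "(\<Sum>k<N. flux p D l k) = W * (of_bool (l \<in> D) - p l) - of_bool (l \<notin> D) * p l * \<Delta>" for l
    unfolding W_def \<Delta>_def by (rule sum_flux_row[OF D])
  have "(\<Sum>l<m. \<Sum>k<N. flux p D l k) = W * deviation p D m - u * \<Delta>"
    unfolding row deviation_def u_def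
    by (simp only: right_diff_distrib sum_subtractf sum_distrib_left sum_distrib_right)
  moreover have "\<bar>u * \<Delta>\<bar> \<le> real N * \<bar>\<Delta>\<bar>"
  proof -
    have "\<bar>u\<bar> \<le> (\<Sum>l<m. \<bar>of_bool (l \<notin> D) * p l\<bar>)"
      unfolding u_def by (rule sum_abs)
    also have "\<dots> \<le> (\<Sum>l<m. 1)"
    proof (rule sum_mono)
      fix l assume "l \<in> {..<m}"
      then show "\<bar>of_bool (l \<notin> D) * p l\<bar> \<le> 1"
        using p[of l] \<open>m \<le> N\<close> by auto
    qed
    also have "\<dots> \<le> real N" using \<open>m \<le> N\<close> by simp
    finally show ?thesis by (simp add: abs_mult mult_right_mono)
  qed
  ultimately show ?thesis unfolding W_def[symmetric] \<Delta>_def[symmetric] by linarith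
qed

text \<open>The random factor in \<open>sum_flux_row\<close> is at least \<open>\<kappa> * (N - a)\<close>, since \<open>N - a\<close> positions are
  outside \<open>D\<close>.\<close>

lemma second_moment_deviation:
  assumes p: "\<And>i. i < N \<Longrightarrow> \<kappa> \<le> p i \<and> p i < 1" and "0 < \<kappa>" and "a < N" and "m \<le> N"
  shows "(\<Sum>D\<in>layer N a. odds_weight p D * (deviation p D m)\<^sup>2)
    \<le> (8 * real N ^ 3 + 2 * (real N * \<bar>real a - (\<Sum>k<N. p k)\<bar>)\<^sup>2) / (\<kappa> * real (N - a))\<^sup>2
       * (\<Sum>D\<in>layer N a. odds_weight p D)"
proof -
  have p': "0 < p i \<and> p i < 1" if "i < N" for i
    using p[OF that] \<open>0 < \<kappa>\<close> by auto
  let ?w = "odds_weight p" and ?E = "real N * \<bar>real a - (\<Sum>k<N. p k)\<bar>"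
  define w0 where "w0 = \<kappa> * real (N - a)"
  have w0: "w0 > 0" using assms by (simp add: w0_def)
  have pt: "(deviation p D m)\<^sup>2 \<le> (2 * (\<Sum>l<m. \<Sum>k<N. flux p D l k)\<^sup>2 + 2 * ?E\<^sup>2) / w0\<^sup>2"
    if D: "D \<in> layer N a" for D
  proof -
    let ?W = "\<Sum>k<N. of_bool (k \<notin> D) * p k" and ?Z = "\<Sum>l<m. \<Sum>k<N. flux p D l k"
    have "w0 = (\<Sum>k<N. of_bool (k \<notin> D) * \<kappa>)"
    proof -
      have "card ({..<N} - D) = N - a"
        using D by (subst card_Diff_subset) (auto simp: layer_def intro: finite_subset)
      moreover have "(\<Sum>k<N. of_bool (k \<notin> D) * \<kappa>) = (\<Sum>k\<in>{..<N} - D. \<kappa>)"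
        by (rule sum.mono_neutral_cong_right) auto
      ultimately show ?thesis by (simp only: w0_def sum_constant mult.commute)
    qed
    also have "\<dots> \<le> ?W"
      using p by (intro sum_mono mult_left_mono) auto
    finally have "w0 * \<bar>deviation p D m\<bar> \<le> ?W * \<bar>deviation p D m\<bar>"
      by (intro mult_right_mono) auto
    also have "\<dots> \<le> \<bar>?W * deviation p D m\<bar>"
      by (simp add: abs_mult mult_right_mono)
    also have "\<dots> \<le> \<bar>?Z\<bar> + ?E"
      by (rule deviation_mult_le[OF p' D \<open>m \<le> N\<close>])
    finally have "(w0 * \<bar>deviation p D m\<bar>)\<^sup>2 \<le> (\<bar>?Z\<bar> + ?E)\<^sup>2"
      using w0 by (intro power_mono) auto
    also have "\<dots> \<le> 2 * ?Z\<^sup>2 + 2 * ?E\<^sup>2"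
      using sum_squares_bound[of "\<bar>?Z\<bar>" ?E] by (simp add: power2_sum)
    finally show ?thesis
      using w0 by (simp add: pos_le_divide_eq power_mult_distrib mult.commute)
  qed
  have "(\<Sum>D\<in>layer N a. ?w D * (deviation p D m)\<^sup>2)
      \<le> (\<Sum>D\<in>layer N a. ?w D * ((2 * (\<Sum>l<m. \<Sum>k<N. flux p D l k)\<^sup>2 + 2 * ?E\<^sup>2) / w0\<^sup>2))"
    using pt odds_weight_nonneg[OF _ p'] by (intro sum_mono mult_left_mono) auto
  also have "\<dots> = (\<Sum>D\<in>layer N a. 2 / w0\<^sup>2 * (?w D * (\<Sum>l<m. \<Sum>k<N. flux p D l k)\<^sup>2)
      + 2 * ?E\<^sup>2 / w0\<^sup>2 * ?w D)"
    by (intro sum.cong) (simp_all add: add_divide_distrib algebra_simps)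
  also have "\<dots> = 2 / w0\<^sup>2 * (\<Sum>D\<in>layer N a. ?w D * (\<Sum>l<m. \<Sum>k<N. flux p D l k)\<^sup>2)
      + 2 * ?E\<^sup>2 / w0\<^sup>2 * (\<Sum>D\<in>layer N a. ?w D)"
    by (simp only: sum.distrib sum_distrib_left)
  also have "\<dots> \<le> 2 / w0\<^sup>2 * (4 * real N ^ 3 * (\<Sum>D\<in>layer N a. ?w D))
      + 2 * ?E\<^sup>2 / w0\<^sup>2 * (\<Sum>D\<in>layer N a. ?w D)"
    using second_moment_flux[OF p' \<open>m \<le> N\<close>, where a = a] by (intro add_right_mono mult_left_mono) auto
  also have "\<dots> = (8 * real N ^ 3 + 2 * ?E\<^sup>2) / w0\<^sup>2 * (\<Sum>D\<in>layer N a. ?w D)"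
    by (simp add: add_divide_distrib algebra_simps)
  finally show ?thesis unfolding w0_def .
qed

section \<open>From one time to all times\<close>

text \<open>As the deviation starts at 0 and changes by at most 1 per step, the value \<open>h\<close> at time \<open>m\<close>
  needs at least \<open>h\<close> steps to build up, and during the last \<open>h / 2\<close> of them the deviation is at least
  \<open>h / 2\<close> in absolute value.\<close>

lemma sum_squares_deviation_ge:
  assumes p: "\<And>i. i < N \<Longrightarrow> 0 < p i \<and> p i < 1" and "m \<le> N" and "0 < h" and m: "h \<le> \<bar>deviation p D m\<bar>"
  shows "h ^ 3 / 8 \<le> (\<Sum>j\<le>N. (deviation p D j)\<^sup>2)"
proof -
  have lip: "\<bar>deviation p D m - deviation p D j\<bar> \<le> real (m - j)" if "j \<le> m" for j
  proof -
    have "deviation p D m = deviation p D j + (\<Sum>l\<in>{j..<m}. of_bool (l \<in> D) - p l)"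
      unfolding deviation_def lessThan_atLeast0 using that by (simp add: sum.atLeastLessThan_concat)
    moreover have "\<bar>\<Sum>l\<in>{j..<m}. of_bool (l \<in> D) - p l\<bar> \<le> (\<Sum>l\<in>{j..<m}. 1)"
    proof (intro order.trans[OF sum_abs] sum_mono)
      fix l assume "l \<in> {j..<m}"
      then show "\<bar>of_bool (l \<in> D) - p l\<bar> \<le> 1"
        using p[of l] \<open>m \<le> N\<close> by (auto simp: of_bool_def)
    qed
    ultimately show ?thesis by simp
  qed
  define r where "r = nat \<lfloor>h / 2\<rfloor>"
  have r: "real r \<le> h / 2" "h / 2 \<le> real (r + 1)"
    using \<open>0 < h\<close> unfolding r_def by linarith+
  have "h \<le> real m"
    using lip[of 0] m by (simp add: deviation_def)
  then have "r \<le> m" using r(1) \<open>0 < h\<close> by linarith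
  have "h ^ 3 / 8 = h / 2 * (h / 2)\<^sup>2"
    by (simp add: power2_eq_square power3_eq_cube)
  also have "\<dots> \<le> real (r + 1) * (h / 2)\<^sup>2"
    using r by (intro mult_right_mono) auto
  also have "\<dots> = (\<Sum>j\<in>{m - r..m}. (h / 2)\<^sup>2)"
    using \<open>r \<le> m\<close> by (simp add: Suc_diff_le)
  also have "\<dots> \<le> (\<Sum>j\<in>{m - r..m}. (deviation p D j)\<^sup>2)"
  proof (rule sum_mono)
    fix j assume j: "j \<in> {m - r..m}"
    then have "real (m - j) \<le> real r" by auto
    then have "h / 2 \<le> \<bar>deviation p D j\<bar>"
      using lip[of j] m j r by auto
    then show "(h / 2)\<^sup>2 \<le> (deviation p D j)\<^sup>2"
      using \<open>0 < h\<close> by (subst power2_abs[symmetric]) (intro power_mono, auto)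
  qed
  also have "\<dots> \<le> (\<Sum>j\<le>N. (deviation p D j)\<^sup>2)"
    using \<open>m \<le> N\<close> by (intro sum_mono2) auto
  finally show ?thesis .
qed

text \<open>Markov's inequality for the sum of squares in \<open>sum_squares_deviation_ge\<close>. For \<open>h\<close>
  proportional to \<open>N\<close>, the factor \<open>h ^ 3\<close> beats the \<open>N + 1\<close> second moments that are added up.\<close>

lemma maximal_deviation_weight:
  assumes p: "\<And>i. i < N \<Longrightarrow> \<kappa> \<le> p i \<and> p i < 1" and "0 < \<kappa>" and "a < N" and "0 < h"
  shows "(\<Sum>D | D \<in> layer N a \<and> (\<exists>m\<le>N. h \<le> \<bar>deviation p D m\<bar>). odds_weight p D)
    \<le> 8 / h ^ 3 * (real (N + 1) * ((8 * real N ^ 3 + 2 * (real N * \<bar>real a - (\<Sum>k<N. p k)\<bar>)\<^sup>2)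
         / (\<kappa> * real (N - a))\<^sup>2 * (\<Sum>D\<in>layer N a. odds_weight p D)))"
proof -
  have p': "0 < p i \<and> p i < 1" if "i < N" for i
    using p[OF that] \<open>0 < \<kappa>\<close> by auto
  let ?w = "odds_weight p" and ?E = "{D. D \<in> layer N a \<and> (\<exists>m\<le>N. h \<le> \<bar>deviation p D m\<bar>)}"
  let ?C = "(8 * real N ^ 3 + 2 * (real N * \<bar>real a - (\<Sum>k<N. p k)\<bar>)\<^sup>2) / (\<kappa> * real (N - a))\<^sup>2
       * (\<Sum>D\<in>layer N a. ?w D)"
  have "(\<Sum>D\<in>?E. ?w D) \<le> (\<Sum>D\<in>?E. ?w D * (8 / h ^ 3 * (\<Sum>j\<le>N. (deviation p D j)\<^sup>2)))"
  proof (rule sum_mono)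
    fix D assume D: "D \<in> ?E"
    then obtain m where "m \<le> N" "h \<le> \<bar>deviation p D m\<bar>" by auto
    then have "h ^ 3 / 8 \<le> (\<Sum>j\<le>N. (deviation p D j)\<^sup>2)"
      using p' \<open>0 < h\<close> by (intro sum_squares_deviation_ge) auto
    then have ge: "1 \<le> 8 / h ^ 3 * (\<Sum>j\<le>N. (deviation p D j)\<^sup>2)"
      using \<open>0 < h\<close> by (simp add: field_simps)
    have "0 \<le> ?w D"
      by (rule odds_weight_nonneg[of D N a]) (use D p' in auto)
    from mult_left_mono[OF ge this]
    show "?w D \<le> ?w D * (8 / h ^ 3 * (\<Sum>j\<le>N. (deviation p D j)\<^sup>2))"
      by (simp only: mult_1_right)
  qed
  also have "\<dots> \<le> (\<Sum>D\<in>layer N a. ?w D * (8 / h ^ 3 * (\<Sum>j\<le>N. (deviation p D j)\<^sup>2)))"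
    using odds_weight_nonneg[OF _ p'] \<open>0 < h\<close>
    by (intro sum_mono2 finite_layer mult_nonneg_nonneg sum_nonneg) auto
  also have "\<dots> = 8 / h ^ 3 * (\<Sum>j\<le>N. \<Sum>D\<in>layer N a. ?w D * (deviation p D j)\<^sup>2)"
    by (subst sum.swap) (simp add: sum_distrib_left mult_ac)
  also have "\<dots> \<le> 8 / h ^ 3 * (\<Sum>j\<le>N. ?C)"
    using assms by (intro mult_left_mono sum_mono second_moment_deviation) auto
  finally show ?thesis by simp
qed

section \<open>The law of the down-steps\<close>

text \<open>The down-step of row \<open>i\<close> sits at \<open>x i + (a - Suc i)\<close>, so the positions add up to the size of
  the diagram plus a constant. Hence odds proportional to \<open>q ^ l\<close> give the weight
  \<open>q ^ diagram_size a x\<close> up to a constant factor, which cancels against the normalisation. The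
  event is phrased by an arbitrary predicate \<open>Q\<close> on down-step sets, and the equation is multiplied out
  to avoid a division.\<close>

lemma prob_qvol_pmf_eq:
  assumes "q > 0" and odds: "\<And>l. l < a + b \<Longrightarrow> p l / (1 - p l) = z * q ^ l" and "z > 0"
  shows "measure_pmf.prob (qvol_pmf a b q) {x. Q {l. down_step a x l}}
      * (\<Sum>D\<in>layer (a + b) a. odds_weight p D)
    = (\<Sum>D | D \<in> layer (a + b) a \<and> Q D. odds_weight p D)"
proof -
  let ?D = "\<lambda>x. {l. down_step a x l}" and ?B = "box_partitions a b" and ?Z = "partition_fn a b q"
  define C where "C = z ^ a * q ^ (\<Sum>i<a. a - Suc i)"
  have weight: "odds_weight p (?D x) = C * q ^ diagram_size a x" if x: "x \<in> ?B" for x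
  proof -
    have "odds_weight p (?D x) = (\<Prod>l\<in>?D x. z * q ^ l)"
      unfolding odds_weight_def using down_steps_subset[OF x] by (intro prod.cong refl odds) auto
    also have "\<dots> = (\<Prod>i<a. z * q ^ (x i + (a - Suc i)))"
      unfolding down_steps_eq prod.reindex[OF inj_down_position[OF x]] by simp
    also have "\<dots> = C * q ^ diagram_size a x"
      by (simp only: power_add) (simp add: prod.distrib C_def diagram_size_def power_sum)
    finally show ?thesis .
  qed
  have reindex: "(\<Sum>D | D \<in> layer (a + b) a \<and> R D. odds_weight p D)
      = (\<Sum>x | x \<in> ?B \<and> R (?D x). C * q ^ diagram_size a x)" for R
  proof -
    have "bij_betw ?D {x \<in> ?B. R (?D x)} {D \<in> layer (a + b) a. R D}"
    proof (rule bij_betw_subset[OF bij_betw_down_steps])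
      have "layer (a + b) a = ?D ` ?B"
        using bij_betw_imp_surj_on[OF bij_betw_down_steps[of a b]] by (simp add: layer_def)
      then show "?D ` {x \<in> ?B. R (?D x)} = {D \<in> layer (a + b) a. R D}"
        by (simp only: Compr_image_eq)
    qed blast
    from sum.reindex_bij_betw[OF this, of "odds_weight p", symmetric] show ?thesis
      by (simp add: weight)
  qed
  have sub: "set_pmf (qvol_pmf a b q) \<subseteq> ?B"
    using assms by (auto simp: set_pmf_eq pmf_qvol_pmf split: if_splits)
  have "measure_pmf.prob (qvol_pmf a b q) {x. Q (?D x)}
      = measure_pmf.prob (qvol_pmf a b q) ({x \<in> ?B. Q (?D x)} \<inter> set_pmf (qvol_pmf a b q))"
    using sub by (subst measure_Int_set_pmf[symmetric]) (rule arg_cong[of _ _ "measure_pmf.prob _"], auto)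
  also have "\<dots> = (\<Sum>x | x \<in> ?B \<and> Q (?D x). pmf (qvol_pmf a b q) x)"
    by (simp add: measure_Int_set_pmf measure_measure_pmf_finite finite_box_partitions)
  also have "\<dots> = (\<Sum>x | x \<in> ?B \<and> Q (?D x). q ^ diagram_size a x) / ?Z"
    using assms by (simp add: pmf_qvol_pmf sum_divide_distrib)
  finally have "measure_pmf.prob (qvol_pmf a b q) {x. Q (?D x)} * (C * ?Z)
      = C * (\<Sum>x | x \<in> ?B \<and> Q (?D x). q ^ diagram_size a x)"
    using partition_fn_pos[OF \<open>q > 0\<close>, of a b] by simp
  moreover have "(\<Sum>D\<in>layer (a + b) a. odds_weight p D) = C * ?Z"
    using reindex[of "\<lambda>_. True"] by (simp add: partition_fn_def sum_distrib_left)
  ultimately show ?thesis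
    by (simp add: reindex sum_distrib_left)
qed

section \<open>The limit curve\<close>

text \<open>The logistic function: its odds are \<open>(1 - A) / A * exp (- 2 * c * t)\<close>. Swapping an adjacent
  up-step and down-step changes the size of the diagram by one, so the log-odds of a down-step have to
  change by \<open>- c / n\<close> per step, which is \<open>- 2 * c\<close> per unit of rescaled time.\<close>

definition down_density :: "real \<Rightarrow> real \<Rightarrow> real \<Rightarrow> real" where
  "down_density A c t = (1 - A) * exp (- c * t) / (A * exp (c * t) + (1 - A) * exp (- c * t))"

definition log_mix :: "real \<Rightarrow> real \<Rightarrow> real \<Rightarrow> real" where
  "log_mix A c t = 1 / c * ln (A * exp (c * t) + (1 - A) * exp (- c * t))"

lemma mix_pos:
  assumes "0 < A" "A < 1"
  shows "0 < A * exp (c * t) + (1 - A) * exp (- c * t :: real)"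
  using assms by (intro add_pos_pos mult_pos_pos) auto

lemma down_density_bounds:
  assumes "0 < A" "A < 1"
  shows "0 < down_density A c t" "down_density A c t < 1"
  using assms mix_pos[OF assms, of c t] by (auto simp: down_density_def)

lemma down_density_ge:
  assumes "0 < A" "A < 1" "0 \<le> t" "t \<le> 1"
  shows "(1 - A) * exp (- 2 * \<bar>c\<bar>) \<le> down_density A c t"
proof -
  have ct: "\<bar>c * t\<bar> \<le> \<bar>c\<bar>"
    using assms by (simp add: abs_mult mult_left_le)
  have "A * exp (c * t) + (1 - A) * exp (- c * t) \<le> A * exp \<bar>c\<bar> + (1 - A) * exp \<bar>c\<bar>"
    using assms ct by (intro add_mono mult_left_mono) auto
  then have "A * exp (c * t) + (1 - A) * exp (- c * t) \<le> exp \<bar>c\<bar>"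
    by (simp add: algebra_simps)
  moreover have "exp (- \<bar>c\<bar>) \<le> exp (- c * t)"
    using ct by auto
  ultimately have "(1 - A) * exp (- \<bar>c\<bar>) / exp \<bar>c\<bar> \<le> down_density A c t"
    unfolding down_density_def using assms mix_pos[OF assms(1,2), of c t]
    by (intro frac_le mult_left_mono) auto
  then show ?thesis
    by (simp add: exp_minus field_simps flip: exp_add)
qed

lemma down_density_odds:
  assumes "0 < A" "A < 1"
  shows "down_density A c t / (1 - down_density A c t) = (1 - A) / A * exp (- 2 * c * t)"
proof -
  have "1 - down_density A c t = A * exp (c * t) / (A * exp (c * t) + (1 - A) * exp (- c * t))"
    using mix_pos[OF assms, of c t] by (simp add: down_density_def field_simps)
  then have "down_density A c t / (1 - down_density A c t) = (1 - A) * exp (- c * t) / (A * exp (c * t))"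
    using mix_pos[OF assms, of c t] assms by (simp add: down_density_def)
  also have "\<dots> = (1 - A) / A * (exp (- c * t) / exp (c * t))"
    by simp
  also have "exp (- c * t) / exp (c * t) = exp (- 2 * c * t)"
    by (simp flip: exp_diff)
  finally show ?thesis .
qed

lemma log_mix_has_derivative:
  assumes "0 < A" "A < 1" "c \<noteq> 0"
  shows "(log_mix A c has_real_derivative 1 - 2 * down_density A c t) (at t)"
proof -
  let ?X = "A * exp (c * t)" and ?Y = "(1 - A) * exp (- c * t)"
  have pos: "0 < ?X + ?Y" by (rule mix_pos[OF assms(1,2)])
  have "((\<lambda>t. A * exp (c * t) + (1 - A) * exp (- c * t)) has_real_derivative c * (?X - ?Y)) (at t)"
    by (auto intro!: derivative_eq_intros simp: algebra_simps)
  from DERIV_cmult[OF DERIV_chain2[OF DERIV_ln_divide[OF pos] this], of "1 / c"]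
  have "(log_mix A c has_real_derivative 1 / c * (1 / (?X + ?Y) * (c * (?X - ?Y)))) (at t)"
    unfolding log_mix_def .
  moreover have "1 / c * (1 / (x + y) * (c * (x - y))) = 1 - 2 * (y / (x + y))" if "0 < x + y" for x y :: real
  proof -
    have "1 / c * (1 / (x + y) * (c * (x - y))) = (x - y) / (x + y)"
      using \<open>c \<noteq> 0\<close> by simp
    also have "\<dots> = 1 - 2 * (y / (x + y))"
      using that by (simp add: field_simps)
    finally show ?thesis .
  qed
  from this[OF pos] have "1 / c * (1 / (?X + ?Y) * (c * (?X - ?Y))) = 1 - 2 * down_density A c t"
    by (simp only: down_density_def)
  ultimately show ?thesis by simp
qed

lemma down_density_has_derivative:
  assumes "0 < A" "A < 1"
  shows "(down_density A c has_real_derivative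
    - 2 * c * (down_density A c t * (1 - down_density A c t))) (at t)"
proof -
  let ?X = "A * exp (c * t)" and ?Y = "(1 - A) * exp (- c * t)"
  have pos: "0 < ?X + ?Y" by (rule mix_pos[OF assms])
  have "((\<lambda>t. A * exp (c * t) + (1 - A) * exp (- c * t)) has_real_derivative c * (?X - ?Y)) (at t)"
    "((\<lambda>t. (1 - A) * exp (- c * t)) has_real_derivative - c * ?Y) (at t)"
    by (auto intro!: derivative_eq_intros simp: algebra_simps)
  from DERIV_divide[OF this(2,1)] pos
  have "(down_density A c has_real_derivative
      (- c * ?Y * (?X + ?Y) - ?Y * (c * (?X - ?Y))) / ((?X + ?Y) * (?X + ?Y))) (at t)"
    unfolding down_density_def by simp
  moreover have "(- c * y * (x + y) - y * (c * (x - y))) / ((x + y) * (x + y))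
      = - 2 * c * (y / (x + y) * (1 - y / (x + y)))" if "0 < x + y" for x y :: real
    using that by (simp add: field_simps)
  from this[OF pos] have "(- c * ?Y * (?X + ?Y) - ?Y * (c * (?X - ?Y))) / ((?X + ?Y) * (?X + ?Y))
      = - 2 * c * (down_density A c t * (1 - down_density A c t))"
    by (simp only: down_density_def)
  ultimately show ?thesis by simp
qed

lemma abs_diff_le_of_derivative:
  fixes f f' :: "real \<Rightarrow> real"
  assumes "\<And>x. (f has_real_derivative f' x) (at x)" and "\<And>x. \<bar>f' x\<bar> \<le> K"
  shows "\<bar>f x - f y\<bar> \<le> K * \<bar>x - y\<bar>"
  using field_differentiable_bound[of UNIV f f' K x y] assms by (auto simp: real_norm_def)

lemma log_mix_lipschitz:
  assumes "0 < A" "A < 1" "c \<noteq> 0"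
  shows "\<bar>log_mix A c x - log_mix A c y\<bar> \<le> \<bar>x - y\<bar>"
  using abs_diff_le_of_derivative[OF log_mix_has_derivative[OF assms], of 1 x y] down_density_bounds[OF assms(1,2)]
  by (auto simp: abs_le_iff less_imp_le)

lemma down_density_lipschitz:
  assumes "0 < A" "A < 1"
  shows "\<bar>down_density A c x - down_density A c y\<bar> \<le> 2 * \<bar>c\<bar> * \<bar>x - y\<bar>"
proof (rule abs_diff_le_of_derivative[OF down_density_has_derivative[OF assms]])
  fix t
  have "down_density A c t * (1 - down_density A c t) \<le> 1" "0 \<le> down_density A c t * (1 - down_density A c t)"
    using down_density_bounds[OF assms, of c t] by (auto intro: mult_le_one)
  then show "\<bar>- 2 * c * (down_density A c t * (1 - down_density A c t))\<bar> \<le> 2 * \<bar>c\<bar>"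
    by (simp add: abs_mult mult_left_le)
qed

text \<open>A Riemann sum for the derivative of \<open>log_mix A c\<close>. That derivative is Lipschitz with constant
  \<open>4 * \<bar>c\<bar>\<close>, so each of the at most \<open>N\<close> steps costs at most \<open>4 * \<bar>c\<bar> / N\<close>.\<close>

lemma sum_drift_approx:
  assumes A: "0 < A" "A < 1" and "c \<noteq> 0" and "m \<le> N" "0 < N"
  shows "\<bar>(\<Sum>l<m. 1 - 2 * down_density A c (real l / real N)) - real N * log_mix A c (real m / real N)\<bar> \<le> 4 * \<bar>c\<bar>"
proof -
  let ?x = "\<lambda>l. real l / real N"
  have step: "\<bar>(1 - 2 * down_density A c (?x l)) - real N * (log_mix A c (?x (Suc l)) - log_mix A c (?x l))\<bar>
      \<le> 4 * \<bar>c\<bar> / real N" for l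
  proof -
    have lt: "?x l < ?x (Suc l)" using \<open>0 < N\<close> by (simp add: divide_strict_right_mono)
    obtain y where y: "?x l < y" "y < ?x (Suc l)"
      "log_mix A c (?x (Suc l)) - log_mix A c (?x l) = (?x (Suc l) - ?x l) * (1 - 2 * down_density A c y)"
      using MVT2[OF lt, of "log_mix A c" "\<lambda>t. 1 - 2 * down_density A c t"] log_mix_has_derivative[OF A \<open>c \<noteq> 0\<close>]
      by blast
    have "real N * (log_mix A c (?x (Suc l)) - log_mix A c (?x l)) = 1 - 2 * down_density A c y"
      unfolding y(3) using \<open>0 < N\<close> by (simp add: field_simps)
    then have "(1 - 2 * down_density A c (?x l)) - real N * (log_mix A c (?x (Suc l)) - log_mix A c (?x l))
        = 2 * (down_density A c y - down_density A c (?x l))"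
      by (simp only:) simp
    also have "\<bar>\<dots>\<bar> = 2 * \<bar>down_density A c y - down_density A c (?x l)\<bar>"
      by (simp only: abs_mult)
    also have "\<dots> \<le> 2 * (2 * \<bar>c\<bar> * \<bar>y - ?x l\<bar>)"
      by (intro mult_left_mono down_density_lipschitz[OF A]) simp
    also have "\<dots> \<le> 2 * (2 * \<bar>c\<bar> * (1 / real N))"
    proof (intro mult_left_mono)
      have "?x (Suc l) = ?x l + 1 / real N" by (simp add: add_divide_distrib)
      then show "\<bar>y - ?x l\<bar> \<le> 1 / real N" using y(1,2) by linarith
    qed auto
    finally show ?thesis by simp
  qed
  have "log_mix A c (?x m) = (\<Sum>l<m. log_mix A c (?x (Suc l)) - log_mix A c (?x l))"
    using sum_lessThan_telescope[of "\<lambda>l. log_mix A c (?x l)" m] by (simp add: log_mix_def)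
  moreover have "(\<Sum>l<m. f l) - real N * (\<Sum>l<m. g l) = (\<Sum>l<m. f l - real N * g l)" for f g
    by (simp add: sum_subtractf sum_distrib_left)
  ultimately have "(\<Sum>l<m. 1 - 2 * down_density A c (?x l)) - real N * log_mix A c (?x m)
      = (\<Sum>l<m. (1 - 2 * down_density A c (?x l)) - real N * (log_mix A c (?x (Suc l)) - log_mix A c (?x l)))"
    by (simp only:)
  also have "\<bar>\<dots>\<bar> \<le> (\<Sum>l<m. 4 * \<bar>c\<bar> / real N)"
    using step by (intro order.trans[OF sum_abs] sum_mono)
  also have "\<dots> \<le> 4 * \<bar>c\<bar>"
    using \<open>m \<le> N\<close> \<open>0 < N\<close> by (simp add: field_simps mult_left_mono)
  finally show ?thesis .
qed

text \<open>The numerator in the limit curve is linear in \<open>exp (c * t)\<close> and \<open>exp (- c * t)\<close>, and the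
  quotient is 1 at \<open>t = 0\<close>. So the two coefficients \<open>A\<close> and \<open>1 - A\<close> add up to 1, and both are
  positive because 1 lies strictly between \<open>exp (- c * (2 - 2 * \<rho>))\<close> and \<open>exp (2 * c * \<rho>)\<close> for either
  sign of \<open>c\<close>.\<close>

lemma limit_curve_eq_log_mix:
  assumes "0 < \<rho>" "\<rho> < 1" "c \<noteq> 0"
  obtains A where "0 < A" "A < 1" "limit_curve \<rho> c = log_mix A c" "log_mix A c 1 = 1 - 2 * \<rho>"
proof -
  define u v where "u = exp (- c * (2 - 2 * \<rho>))" and "v = exp (2 * c * \<rho>)"
  define A where "A = (u - 1) / (u - v)"
  have uv: "u < 1 \<and> 1 < v \<or> v < 1 \<and> 1 < u"
    using assms by (cases "c > 0") (auto simp: u_def v_def mult_pos_neg mult_neg_pos mult_pos_pos mult_neg_neg)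
  then have A: "0 < A" "A < 1" by (auto simp: A_def field_simps)
  have "1 - A = ((u - v) - (u - 1)) / (u - v)"
    unfolding diff_divide_distrib[of "u - v"] using uv by (auto simp: A_def)
  then have B: "1 - A = (1 - v) / (u - v)" by simp
  have mix: "A * exp (c * t) + (1 - A) * exp (- c * t) =
      (exp (- c * t) - exp (c * t) + exp (- c * (2 - 2 * \<rho> - t)) - exp (- c * (t - 2 * \<rho>))) / (u - v)" for t
  proof -
    have "exp (- c * (2 - 2 * \<rho> - t)) = u * exp (c * t)" "exp (- c * (t - 2 * \<rho>)) = v * exp (- c * t)"
      by (simp_all add: u_def v_def algebra_simps flip: exp_add)
    then show ?thesis unfolding B by (simp add: A_def algebra_simps add_divide_distrib diff_divide_distrib)
  qed
  have "A * exp (c * 1) + (1 - A) * exp (- c * 1) = exp (c * (1 - 2 * \<rho>))"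
  proof -
    have "exp (c * (1 - 2 * \<rho>)) * (u - v) = exp (- c) - exp c"
      by (simp add: u_def v_def algebra_simps flip: exp_add)
    moreover have "exp (- c * (2 - 2 * \<rho> - 1)) = exp (- c * (1 - 2 * \<rho>))"
      by (simp add: algebra_simps)
    ultimately show ?thesis
      unfolding mix using uv by (auto simp: field_simps)
  qed
  then have "log_mix A c 1 = 1 - 2 * \<rho>"
    using assms by (simp add: log_mix_def)
  moreover have "limit_curve \<rho> c = log_mix A c"
    unfolding limit_curve_def log_mix_def mix u_def v_def by (rule ext) simp
  ultimately show ?thesis using that A by blast
qed

section \<open>Concentration of the boundary path\<close>

lemma boundary_eq_sum:
  "real_of_int (boundary a x m) = (\<Sum>l<m. 1 - 2 * p l) - 2 * deviation p {l. down_step a x l} m"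
proof -
  have "real_of_int (boundary a x m) = (\<Sum>l<m. (1 - 2 * p l) - 2 * (of_bool (down_step a x l) - p l))"
    unfolding boundary_def of_int_sum by (rule sum.cong) auto
  then show ?thesis
    by (simp add: deviation_def sum_subtractf sum_distrib_left)
qed

lemma boundary_lin_approx:
  assumes "0 \<le> s"
  shows "\<bar>boundary_lin a x s - real_of_int (boundary a x (nat \<lfloor>s\<rfloor>))\<bar> \<le> 1"
proof -
  define k where "k = nat \<lfloor>s\<rfloor>"
  have "\<bar>real_of_int (boundary a x (Suc k) - boundary a x k)\<bar> = 1"
    by (simp add: boundary_def)
  moreover have "\<bar>s - real k\<bar> \<le> 1"
    using assms unfolding k_def by linarith
  ultimately show ?thesis
    by (simp add: boundary_lin_def Let_def k_def abs_mult)
qed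

text \<open>The bounded error has three sources: interpolation between integer times costs 1, rounding
  the argument of the 1-Lipschitz curve costs 1, and the Riemann sum costs \<open>4 * \<bar>c\<bar>\<close>. The rest is
  random.\<close>

lemma boundary_lin_near_log_mix:
  assumes A: "0 < A" "A < 1" and "c \<noteq> 0" and "0 < N" and t: "0 \<le> t" "t \<le> 1"
  obtains k where "k \<le> N" and
    "\<bar>boundary_lin a x (t * real N) / real N - log_mix A c t\<bar>
      \<le> (4 * \<bar>c\<bar> + 2 + 2 * \<bar>deviation (\<lambda>l. down_density A c (real l / real N)) {l. down_step a x l} k\<bar>) / real N"
proof -
  let ?p = "\<lambda>l. down_density A c (real l / real N)"
  define k where "k = nat \<lfloor>t * real N\<rfloor>"
  have tN: "0 \<le> t * real N" "t * real N \<le> real N"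
    using t by (auto simp: mult_left_le_one_le)
  have k: "real k \<le> t * real N" "t * real N < real k + 1"
    using tN unfolding k_def by linarith+
  then have "k \<le> N" using tN(2) by linarith
  have "\<bar>log_mix A c t - log_mix A c (real k / real N)\<bar> \<le> \<bar>t - real k / real N\<bar>"
    by (rule log_mix_lipschitz[OF A \<open>c \<noteq> 0\<close>])
  also have "t - real k / real N = (t * real N - real k) / real N"
    using \<open>0 < N\<close> by (simp add: diff_divide_distrib)
  also have "\<bar>\<dots>\<bar> \<le> 1 / real N"
    using k \<open>0 < N\<close> by (simp add: divide_right_mono)
  finally have "real N * \<bar>log_mix A c t - log_mix A c (real k / real N)\<bar> \<le> 1"
    using \<open>0 < N\<close> by (simp add: field_simps)
  then have "\<bar>real N * log_mix A c t - real N * log_mix A c (real k / real N)\<bar> \<le> 1"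
    by (simp add: abs_mult flip: right_diff_distrib)
  moreover have "\<bar>boundary_lin a x (t * real N) - real_of_int (boundary a x k)\<bar> \<le> 1"
    unfolding k_def by (rule boundary_lin_approx[OF tN(1)])
  moreover have "\<bar>(\<Sum>l<k. 1 - 2 * ?p l) - real N * log_mix A c (real k / real N)\<bar> \<le> 4 * \<bar>c\<bar>"
    by (rule sum_drift_approx[OF A \<open>c \<noteq> 0\<close> \<open>k \<le> N\<close> \<open>0 < N\<close>])
  ultimately have "\<bar>boundary_lin a x (t * real N) - real N * log_mix A c t\<bar>
      \<le> 4 * \<bar>c\<bar> + 2 + 2 * \<bar>deviation ?p {l. down_step a x l} k\<bar>"
    using boundary_eq_sum[of a x k ?p] by linarith
  moreover have "boundary_lin a x (t * real N) / real N - log_mix A c t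
      = (boundary_lin a x (t * real N) - real N * log_mix A c t) / real N"
    using \<open>0 < N\<close> by (simp add: field_simps)
  ultimately have "\<bar>boundary_lin a x (t * real N) / real N - log_mix A c t\<bar>
      \<le> (4 * \<bar>c\<bar> + 2 + 2 * \<bar>deviation ?p {l. down_step a x l} k\<bar>) / real N"
    using \<open>0 < N\<close> by (simp add: divide_right_mono)
  with \<open>k \<le> N\<close> show ?thesis by (rule that)
qed

text \<open>The value of \<open>log_mix A c\<close> at time 1 determines the sum of all \<open>p l\<close>, hence the defect
  \<open>a - (\<Sum>l. p l)\<close>, up to the error \<open>2 * \<bar>c\<bar>\<close> of the Riemann sum; and
  \<open>(1 - A) * exp (- 2 * \<bar>c\<bar>)\<close> is the lower bound \<open>\<kappa>\<close> for the \<open>p l\<close>.\<close>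

lemma prob_deviation_le:
  assumes A: "0 < A" "A < 1" and "c \<noteq> 0" and endpoint: "log_mix A c 1 = 1 - 2 * \<rho>"
    and ab: "0 < b" "0 < n" "a + b = 2 * n" and "0 < h"
  defines "N \<equiv> real (a + b)"
  shows "measure_pmf.prob (qvol_pmf a b (exp (- c / real n)))
      {x. \<exists>m\<le>a + b. h \<le> \<bar>deviation (\<lambda>l. down_density A c (real l / N)) {l. down_step a x l} m\<bar>}
    \<le> 8 / h ^ 3 * ((N + 1) * ((8 * N ^ 3 + 2 * (N * (\<bar>real a - \<rho> * N\<bar> + 2 * \<bar>c\<bar>))\<^sup>2)
         / ((1 - A) * exp (- 2 * \<bar>c\<bar>) * real b)\<^sup>2))"
proof -
  let ?p = "\<lambda>l. down_density A c (real l / N)" and ?q = "exp (- c / real n)"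
  let ?\<kappa> = "(1 - A) * exp (- 2 * \<bar>c\<bar>)"
  let ?T = "\<Sum>D\<in>layer (a + b) a. odds_weight ?p D"
  let ?P = "measure_pmf.prob (qvol_pmf a b ?q) {x. \<exists>m\<le>a + b. h \<le> \<bar>deviation ?p {l. down_step a x l} m\<bar>}"
  have N: "N > 0" "N = 2 * real n" using ab by (simp_all add: N_def)
  have p: "?\<kappa> \<le> ?p i \<and> ?p i < 1" if "i < a + b" for i
    using that N(1) A by (intro conjI down_density_ge down_density_bounds) (auto simp: N_def)
  have odds: "?p l / (1 - ?p l) = (1 - A) / A * ?q ^ l" for l
  proof -
    have "exp (- 2 * c * (real l / N)) = ?q ^ l"
      using ab by (simp add: N(2) flip: exp_of_nat_mult)
    then show ?thesis by (simp add: down_density_odds[OF A])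
  qed
  have T: "?T > 0"
  proof -
    have "layer (a + b) a \<noteq> {}"
    proof -
      have "{..<a} \<in> layer (a + b) a" by (auto simp: layer_def)
      then show ?thesis by blast
    qed
    moreover have "odds_weight ?p D > 0" if "D \<in> layer (a + b) a" for D
      unfolding odds_weight_def using down_density_bounds[OF A] by (intro prod_pos) auto
    ultimately show ?thesis using finite_layer by (intro sum_pos) auto
  qed
  define \<Delta> where "\<Delta> = \<bar>real a - (\<Sum>k<a + b. ?p k)\<bar>"
  have "\<bar>(\<Sum>l<a + b. 1 - 2 * ?p l) - N * (1 - 2 * \<rho>)\<bar> \<le> 4 * \<bar>c\<bar>"
    using sum_drift_approx[OF A \<open>c \<noteq> 0\<close>, of "a + b" "a + b"] ab(1) endpoint by (simp add: N_def)
  then have "\<bar>2 * \<rho> * N - 2 * (\<Sum>l<a + b. ?p l)\<bar> \<le> 4 * \<bar>c\<bar>"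
    by (simp add: sum_subtractf sum_distrib_left N_def algebra_simps)
  then have \<Delta>: "\<Delta> \<le> \<bar>real a - \<rho> * N\<bar> + 2 * \<bar>c\<bar>" "0 \<le> \<Delta>"
    unfolding \<Delta>_def by linarith+
  have "?P * ?T \<le> 8 / h ^ 3 * ((N + 1) * ((8 * N ^ 3 + 2 * (N * \<Delta>)\<^sup>2) / (?\<kappa> * real b)\<^sup>2 * ?T))"
    using maximal_deviation_weight[of "a + b" ?\<kappa> ?p a h, OF p] A ab(1) \<open>0 < h\<close>
    by (subst prob_qvol_pmf_eq[OF _ odds]) (simp_all add: N_def \<Delta>_def add_ac)
  also have "\<dots> = 8 / h ^ 3 * ((N + 1) * ((8 * N ^ 3 + 2 * (N * \<Delta>)\<^sup>2) / (?\<kappa> * real b)\<^sup>2)) * ?T"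
    by simp
  finally have "?P \<le> 8 / h ^ 3 * ((N + 1) * ((8 * N ^ 3 + 2 * (N * \<Delta>)\<^sup>2) / (?\<kappa> * real b)\<^sup>2))"
    using T by (rule mult_right_le_imp_le)
  also have "\<dots> \<le> 8 / h ^ 3 * ((N + 1) * ((8 * N ^ 3 + 2 * (N * (\<bar>real a - \<rho> * N\<bar> + 2 * \<bar>c\<bar>))\<^sup>2) / (?\<kappa> * real b)\<^sup>2))"
    using \<open>0 < h\<close> N \<Delta> by (intro mult_left_mono divide_right_mono add_left_mono power_mono) auto
  finally show ?thesis .
qed

theorem theorem1:
  fixes \<rho> c :: real and a b :: "nat \<Rightarrow> nat"
  assumes "0 < \<rho>" "\<rho> < 1" and "c \<noteq> 0"
    and "\<And>n. n \<ge> 1 \<Longrightarrow> a n > 0" and "\<And>n. n \<ge> 1 \<Longrightarrow> b n > 0"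
    and "\<And>n. n \<ge> 1 \<Longrightarrow> a n + b n = 2 * n"
    and "(\<lambda>n. real (a n) / real (b n)) \<longlonglongrightarrow> \<rho> / (1 - \<rho>)"
  shows "\<forall>\<epsilon>>0. (\<lambda>n. measure_pmf.prob (qvol_pmf (a n) (b n) (exp (- c / real n)))
     {p. (SUP t\<in>{0..1}. \<bar>boundary_lin (a n) p (2 * t * real n) / (2 * real n) - limit_curve \<rho> c t\<bar>) > \<epsilon>})
     \<longlonglongrightarrow> 0"
proof (intro allI impI)
  fix \<epsilon> :: real assume "\<epsilon> > 0"
  obtain A where A: "0 < A" "A < 1" and curve: "limit_curve \<rho> c = log_mix A c" and
    endpoint: "log_mix A c 1 = 1 - 2 * \<rho>"
    using limit_curve_eq_log_mix[OF assms(1-3)] .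
  define N where "N n = 2 * real n" for n
  define \<kappa> where "\<kappa> = (1 - A) * exp (- 2 * \<bar>c\<bar>)"
  let ?P = "\<lambda>n. measure_pmf.prob (qvol_pmf (a n) (b n) (exp (- c / real n)))
     {p. (SUP t\<in>{0..1}. \<bar>boundary_lin (a n) p (2 * t * real n) / (2 * real n) - limit_curve \<rho> c t\<bar>) > \<epsilon>}"
  \<comment> \<open>In \<open>boundary_lin_near_log_mix\<close> the deviation enters twice, and half of \<open>\<epsilon>\<close> is reserved for the
    bounded error.\<close>
  let ?h = "\<lambda>n. \<epsilon> / 4 * N n"
  define R where "R n = 8 / ?h n ^ 3 * ((N n + 1) * ((8 * N n ^ 3 + 2 * (N n * (\<bar>real (a n) - \<rho> * N n\<bar> + 2 * \<bar>c\<bar>))\<^sup>2)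
         / (\<kappa> * real (b n))\<^sup>2))" for n
  have N: "filterlim N at_top sequentially"
    unfolding N_def by real_asymp
  have bound: "?P n \<le> R n" if n: "n \<ge> 1" "N n \<ge> (4 * \<bar>c\<bar> + 2) * 2 / \<epsilon>" for n
  proof -
    have ab: "0 < b n" "0 < n" "a n + b n = 2 * n" and Nn: "N n = real (a n + b n)" "N n > 0"
      using assms(5,6)[OF n(1)] n(1) by (simp_all add: N_def)
    let ?p = "\<lambda>l. down_density A c (real l / N n)"
    have "{p. (SUP t\<in>{0..1}. \<bar>boundary_lin (a n) p (2 * t * real n) / (2 * real n) - limit_curve \<rho> c t\<bar>) > \<epsilon>}
        \<subseteq> {x. \<exists>m\<le>a n + b n. ?h n \<le> \<bar>deviation ?p {l. down_step (a n) x l} m\<bar>}" (is "?S \<subseteq> ?S'")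
    proof
      fix x assume x: "x \<in> ?S"
      \<comment> \<open>Otherwise \<open>\<epsilon>\<close> is an upper bound of the nonempty set under the supremum.\<close>
      have "\<exists>t\<in>{0..1}. \<epsilon> < \<bar>boundary_lin (a n) x (2 * t * real n) / (2 * real n) - limit_curve \<rho> c t\<bar>"
      proof (rule ccontr)
        assume "\<not> ?thesis"
        then have "(SUP t\<in>{0..1}. \<bar>boundary_lin (a n) x (2 * t * real n) / (2 * real n) - limit_curve \<rho> c t\<bar>) \<le> \<epsilon>"
          by (intro cSUP_least) (auto simp: not_less)
        with x show False by auto
      qed
      then obtain t where t: "0 \<le> t" "t \<le> 1"
        "\<epsilon> < \<bar>boundary_lin (a n) x (t * N n) / N n - log_mix A c t\<bar>"
        by (auto simp: N_def curve mult_ac)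
      obtain k where k: "k \<le> a n + b n" "\<bar>boundary_lin (a n) x (t * N n) / N n - log_mix A c t\<bar>
          \<le> (4 * \<bar>c\<bar> + 2 + 2 * \<bar>deviation ?p {l. down_step (a n) x l} k\<bar>) / N n"
        using boundary_lin_near_log_mix[OF A assms(3) _ t(1,2), of "a n + b n" "a n" x] ab unfolding Nn by auto
      have "\<epsilon> < (4 * \<bar>c\<bar> + 2 + 2 * \<bar>deviation ?p {l. down_step (a n) x l} k\<bar>) / N n"
        using t(3) k(2) by linarith
      then have "\<epsilon> * N n < 4 * \<bar>c\<bar> + 2 + 2 * \<bar>deviation ?p {l. down_step (a n) x l} k\<bar>"
        using Nn(2) by (simp add: field_simps)
      moreover have "4 * \<bar>c\<bar> + 2 \<le> \<epsilon> * N n / 2"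
        using n(2) \<open>\<epsilon> > 0\<close> by (simp add: field_simps)
      moreover have "y / 4 \<le> d" if "y < u + 2 * d" "u \<le> y / 2" for y u d :: real
        using that by linarith
      ultimately have "\<epsilon> * N n / 4 \<le> \<bar>deviation ?p {l. down_step (a n) x l} k\<bar>"
        by blast
      then have "?h n \<le> \<bar>deviation ?p {l. down_step (a n) x l} k\<bar>"
        by (simp only: times_divide_eq_left)
      with k(1) show "x \<in> ?S'" by blast
    qed
    then have "?P n \<le> measure_pmf.prob (qvol_pmf (a n) (b n) (exp (- c / real n))) ?S'"
      by (intro measure_pmf.finite_measure_mono) auto
    also have "\<dots> \<le> R n"
      using prob_deviation_le[OF A assms(3) endpoint ab, of "?h n"] \<open>\<epsilon> > 0\<close> Nn(2)
      unfolding R_def \<kappa>_def Nn(1)[symmetric] by simp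
    finally show ?thesis .
  qed
  have R: "R \<longlonglongrightarrow> 0"
  proof -
    have ratio: "(\<lambda>n. real (a n) / N n) \<longlonglongrightarrow> \<rho>"
    proof -
      have "(\<lambda>n. (real (a n) / real (b n)) / (1 + real (a n) / real (b n))) \<longlonglongrightarrow> (\<rho> / (1 - \<rho>)) / (1 + \<rho> / (1 - \<rho>))"
        using assms(1,2) by (intro assms(7) tendsto_divide tendsto_add tendsto_const) (auto simp: field_simps)
      moreover have "(\<rho> / (1 - \<rho>)) / (1 + \<rho> / (1 - \<rho>)) = \<rho>"
        using assms(1,2) by (simp add: field_simps)
      moreover have "\<forall>\<^sub>F n in sequentially. (real (a n) / real (b n)) / (1 + real (a n) / real (b n)) = real (a n) / N n"
        using eventually_ge_at_top[of 1]
      proof eventually_elim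
        case (elim n)
        then have "N n = real (a n) + real (b n)" "real (b n) > 0"
          using assms(5,6)[OF elim] by (simp_all add: N_def flip: of_nat_add)
        then show ?case by (simp add: field_simps)
      qed
      ultimately show ?thesis
        by (simp only:) (rule Lim_transform_eventually)
    qed
    \<comment> \<open>All quantities in \<open>R\<close> are expressed by \<open>1 / N n\<close> and \<open>r n\<close>, which converge.\<close>
    define r where "r n = real (a n) / N n" for n
    have inv: "(\<lambda>n. 1 / N n) \<longlonglongrightarrow> 0"
      unfolding N_def by real_asymp
    have "(\<lambda>n. 8 / ((\<epsilon> / 4) ^ 3 * \<kappa>\<^sup>2) * ((1 + 1 / N n) * (8 * (1 / N n) + 2 * (\<bar>r n - \<rho>\<bar> + 2 * \<bar>c\<bar> * (1 / N n))\<^sup>2) / (1 - r n)\<^sup>2))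
        \<longlonglongrightarrow> 8 / ((\<epsilon> / 4) ^ 3 * \<kappa>\<^sup>2) * ((1 + 0) * (8 * 0 + 2 * (\<bar>\<rho> - \<rho>\<bar> + 2 * \<bar>c\<bar> * 0)\<^sup>2) / (1 - \<rho>)\<^sup>2)"
      using assms(2) ratio inv unfolding r_def by (intro tendsto_intros) auto
    moreover have "\<forall>\<^sub>F n in sequentially. 8 / ((\<epsilon> / 4) ^ 3 * \<kappa>\<^sup>2) * ((1 + 1 / N n) * (8 * (1 / N n) + 2 * (\<bar>r n - \<rho>\<bar> + 2 * \<bar>c\<bar> * (1 / N n))\<^sup>2) / (1 - r n)\<^sup>2) = R n"
      using eventually_ge_at_top[of 1]
    proof eventually_elim
      case (elim n)
      define M where "M = N n"
      have "M = real (a n) + real (b n)"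
        using assms(6)[OF elim] by (simp add: M_def N_def flip: of_nat_add)
      moreover have "M > 0" "real (a n) = r n * M"
        using elim by (simp_all add: M_def N_def r_def)
      ultimately have M: "M > 0" "real (a n) = r n * M" "real (b n) = (1 - r n) * M"
        by (simp_all add: algebra_simps)
      have "\<bar>real (a n) - \<rho> * M\<bar> = \<bar>r n - \<rho>\<bar> * M"
        using M(1) by (simp add: M(2) abs_mult flip: left_diff_distrib)
      moreover have "\<kappa> > 0"
        using A by (simp add: \<kappa>_def)
      moreover have "0 < (1 - r n) * M"
        using assms(5)[OF elim] unfolding M(3)[symmetric] by simp
      then have "1 - r n > 0"
        using M(1) by (rule zero_less_mult_pos2)
      ultimately show ?case
        unfolding R_def M_def[symmetric] M(3) using \<open>\<epsilon> > 0\<close> M(1)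
        by (simp add: divide_simps) (simp add: algebra_simps eval_nat_numeral)
    qed
    ultimately have "R \<longlonglongrightarrow> 8 / ((\<epsilon> / 4) ^ 3 * \<kappa>\<^sup>2) * ((1 + 0) * (8 * 0 + 2 * (\<bar>\<rho> - \<rho>\<bar> + 2 * \<bar>c\<bar> * 0)\<^sup>2) / (1 - \<rho>)\<^sup>2)"
      by (rule Lim_transform_eventually)
    then show ?thesis by simp
  qed
  have le: "\<forall>\<^sub>F n in sequentially. ?P n \<le> R n"
    using eventually_ge_at_top[of 1] N[THEN filterlim_at_top[THEN iffD1, rule_format]]
    by (rule eventually_elim2) (rule bound)
  show "?P \<longlonglongrightarrow> 0"
    by (rule tendsto_sandwich[OF _ le tendsto_const R]) simp
qed

end
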